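(* Let $G$ be a graph on $V=\{1,\dots,n\}$, let $d\ge1$ be an integer, and let $x$ and $\tilde x$ be the PageRank vectors, with the same damping factor $\alpha\in[0,1)$, of two graphs in $\mathcal{N}^d_G(\deg_{\mathrm{out}})$, where color refinement aggregates over in-neighbors and starts from the out-degrees as initial colors. Let $x^{(t)}$ be the PageRank power iteration, with damping factor $\alpha$, of the first graph, started at a constant nonnegative vector $x^{(0)}=\mathrm{const}\cdot\mathbb{1}_n$. Then for every integer $k$ with $1\le k\le d$, $$\lVert x-\tilde x\rVert_1\le\frac{2}{1-\alpha}\,\lVert x^{(k-1)}-x^{(k)}\rVert_1.$$
   Context: Color refinement over in-neighbors: fix an injective function $\operatorname{hash}$, the same for all graphs and iterations. With initial colors $c^{(0)}$, set $c^{(t+1)}(v)=\operatorname{hash}\big(c^{(t)}(v),\{\{c^{(t)}(x):x\in N_{\mathrm{in}}(v)\}\}\big)$, where $N_{\mathrm{in}}(v)=\{x:xv\in E\}$ and $\{\{\cdot\}\}$ denotes a multiset. The set $\mathcal{N}^d_G(\deg_{\mathrm{out}})$ consists of all labeled graphs $G'$ on $V$ such that, with initial colors $c^{(0)}=\deg_{\mathrm{out}}$ in each graph (each graph's own out-degrees), $c^{(d)}_{G'}(v)=c^{(d)}_G(v)$ for all $v\in V$; in particular, since hash is injective, $G'$ and $G$ have the same colors at all depths $t\le d$ and the same out-degrees. The graph $G$ itself belongs to this set. PageRank power iteration of a graph with adjacency matrix $A$ ($A_{ij}=1$ iff $ij\in E$, else $0$): $$x^{(t+1)}=\alpha\,\bar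 A^\top D_{\mathrm{out}}^{-1}x^{(t)}+\frac{1-\alpha}{n}\mathbb{1}_n,$$ where $\bar A$ is the adjacency matrix of the augmented graph in which each node of out-degree zero is connected to all nodes, $D_{\mathrm{out}}=\operatorname{diag}(\bar A\mathbb{1}_n)$, and $\mathbb{1}_n$ is the all-ones vector. The PageRank vector $x$ of the graph (normalized to $\lVert x\rVert_1=1$) is the unique fixed point of this iteration for $\alpha<1$. *)

theory Defs
  imports "HOL-Analysis.Analysis" "HOL-Library.Multiset"
begin

text \<open>
  A directed graph on n vertices is an edge set \<open>E :: 'n rel\<close> over a finite vertex type
  with \<open>CARD('n)\<close> = n; a pair \<open>(i, j) \<in> E\<close> is an edge from i to j. Loops are permitted.
\<close>

definition out_degree :: "('n::finite) rel \<Rightarrow> 'n \<Rightarrow> nat" where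
  "out_degree E v = card {w. (v, w) \<in> E}"

definition in_neighbors :: "('n::finite) rel \<Rightarrow> 'n \<Rightarrow> 'n set" where
  "in_neighbors E v = {u. (u, v) \<in> E}"

primrec color_refinement ::
    "('c \<times> 'c multiset \<Rightarrow> 'c) \<Rightarrow> ('n::finite) rel \<Rightarrow> ('n \<Rightarrow> 'c) \<Rightarrow> nat \<Rightarrow> 'n \<Rightarrow> 'c" where
  "color_refinement hash E c0 0 = c0"
| "color_refinement hash E c0 (Suc t) = (\<lambda>v.
     hash (color_refinement hash E c0 t v,
           {# color_refinement hash E c0 t u. u \<in># mset_set (in_neighbors E v) #}))"

text \<open>
  The argument \<open>init\<close> assigns initial colors to every graph, so that each graph
  is refined starting from its own initial coloring.
\<close>

definition refinement_neighborhood ::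
    "('c \<times> 'c multiset \<Rightarrow> 'c) \<Rightarrow> (('n::finite) rel \<Rightarrow> 'n \<Rightarrow> 'c) \<Rightarrow> nat \<Rightarrow> 'n rel \<Rightarrow> 'n rel set" where
  "refinement_neighborhood hash init d G =
     {G'. \<forall>v. color_refinement hash G' (init G') d v = color_refinement hash G (init G) d v}"

definition adjacency_matrix :: "('n::finite) rel \<Rightarrow> real^'n^'n" where
  "adjacency_matrix E = (\<chi> i j. if (i, j) \<in> E then 1 else 0)"

definition augment :: "('n::finite) rel \<Rightarrow> 'n rel" where
  "augment E = E \<union> {(i, j). out_degree E i = 0}"

definition diag :: "real^'n \<Rightarrow> real^'n^'n" where
  "diag v = (\<chi> i j. if i = j then v $ i else 0)"

text \<open>In the type \<open>real^'n\<close>, the constant \<open>1\<close> is the all-ones vector.\<close>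

definition pagerank_step :: "real \<Rightarrow> ('n::finite) rel \<Rightarrow> real^'n \<Rightarrow> real^'n" where
  "pagerank_step \<alpha> E x =
     (let A = adjacency_matrix (augment E); D = diag (A *v 1)
      in \<alpha> *\<^sub>R ((transpose A ** matrix_inv D) *v x) + ((1 - \<alpha>) / real CARD('n)) *\<^sub>R 1)"

definition pagerank_iterate :: "real \<Rightarrow> ('n::finite) rel \<Rightarrow> real^'n \<Rightarrow> nat \<Rightarrow> real^'n" where
  "pagerank_iterate \<alpha> E x0 t = (pagerank_step \<alpha> E ^^ t) x0"

text \<open>The library norm on \<open>real^'n\<close> is the Euclidean one.\<close>

definition l1_norm :: "real^('n::finite) \<Rightarrow> real" where
  "l1_norm x = (\<Sum>i\<in>UNIV. \<bar>x $ i\<bar>)"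

definition pagerank :: "real \<Rightarrow> ('n::finite) rel \<Rightarrow> real^'n" where
  "pagerank \<alpha> E = (THE x. pagerank_step \<alpha> E x = x \<and> l1_norm x = 1)"

end

theory Submission
  imports Defs
begin

text \<open>
  On node colors of depth \<open>t\<close>, the \<open>t\<close>-th power iterate is a function of the color, and the
  function is the same for any two graphs of the neighborhood; hence they share the iterates up
  to step \<open>d\<close>. So the PageRank steps of both graphs map the iterate \<open>y\<close> at \<open>k - 1\<close> to the same
  vector \<open>z\<close>. Each step is an \<open>\<alpha>\<close>-contraction in the 1-norm, so both fixed points lie within
  \<open>\<parallel>y - z\<parallel>\<^sub>1 / (1 - \<alpha>)\<close> of \<open>y\<close>.
\<close>

section \<open>The 1-norm\<close>

lemma l1_norm_triangle: "l1_norm (x + y) \<le> l1_norm x + l1_norm y"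
  unfolding l1_norm_def sum.distrib[symmetric] by (intro sum_mono) simp

lemma l1_norm_nonneg: "0 \<le> l1_norm x"
  by (simp add: l1_norm_def sum_nonneg)

lemma l1_norm_minus_commute: "l1_norm (x - y) = l1_norm (y - x)"
  by (simp add: l1_norm_def abs_minus_commute)

lemma l1_norm_scaleR: "l1_norm (a *\<^sub>R x) = \<bar>a\<bar> * l1_norm x"
  by (simp add: l1_norm_def abs_mult sum_distrib_left)

lemma l1_norm_eq_0_iff: "l1_norm x = 0 \<longleftrightarrow> x = 0"
  by (simp add: l1_norm_def sum_nonneg_eq_0_iff vec_eq_iff)

section \<open>Inverses of diagonal matrices\<close>

lemma diag_nth: "diag w $ i $ j = (if i = j then w $ i else 0)"
  by (simp add: diag_def)

lemma matrix_mult_diag: "(A ** diag w) $ i $ j = A $ i $ j * w $ j"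
  by (simp add: diag_def matrix_matrix_mult_def if_distrib cong: if_cong)

text \<open>\<open>matrix_inv\<close> is a choice. The chosen matrix is a right inverse of
  \<open>A\<close>, and multiplying by \<open>B\<close> from the left identifies it with
  \<open>B\<close>.\<close>

lemma matrix_inv_eq:
  fixes A B :: "real^'n^'n"
  assumes "A ** B = mat 1" "B ** A = mat 1"
  shows "matrix_inv A = B"
proof -
  have "A ** matrix_inv A = mat 1"
    using someI[of "\<lambda>C. A ** C = mat 1 \<and> C ** A = mat 1" B] assms
    by (simp add: matrix_inv_def)
  then have "B ** (A ** matrix_inv A) = B"
    by simp
  then show ?thesis
    by (simp add: matrix_mul_assoc assms(2))
qed

lemma matrix_inv_diag:
  fixes v :: "real^('n::finite)"
  assumes "\<And>i. v $ i \<noteq> 0"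
  shows "matrix_inv (diag v) = diag (\<chi> i. inverse (v $ i))"
  by (rule matrix_inv_eq)
    (auto simp: vec_eq_iff matrix_mult_diag mat_def diag_nth assms)

section \<open>The augmented graph\<close>

lemma out_degree_augment:
  "out_degree (augment E) i = (if out_degree E i = 0 then CARD('n) else out_degree E i)"
  for E :: "('n::finite) rel"
proof (cases "out_degree E i = 0")
  case True
  then have "{w. (i, w) \<in> augment E} = UNIV"
    by (auto simp: augment_def)
  then show ?thesis
    using True by (simp add: out_degree_def)
next
  case False
  then have "{w. (i, w) \<in> augment E} = {w. (i, w) \<in> E}"
    by (auto simp: augment_def)
  then show ?thesis
    using False by (simp add: out_degree_def)
qed

lemma out_degree_augment_pos: "0 < out_degree (augment E) i"
  by (simp add: out_degree_augment)

lemma in_neighbors_augment: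
  "in_neighbors (augment E) i = in_neighbors E i \<union> {u. out_degree E u = 0}"
  by (auto simp: augment_def in_neighbors_def)

text \<open>This makes the union in \<open>in_neighbors_augment\<close> disjoint.\<close>

lemma out_degree_in_neighbors: "u \<in> in_neighbors E v \<Longrightarrow> out_degree E u \<noteq> 0"
  by (auto simp: in_neighbors_def out_degree_def)

section \<open>The linear part of the PageRank step\<close>

text \<open>The matrix of the power iteration, written as a sum over in-neighbors so that later
  arguments meet no matrix inverse.\<close>

definition spread :: "('n::finite) rel \<Rightarrow> real^'n \<Rightarrow> real^'n" where
  "spread E x = (\<chi> i. \<Sum>j\<in>in_neighbors (augment E) i. x $ j / real (out_degree (augment E) j))"

lemma adjacency_matrix_mult_1: "adjacency_matrix E *v 1 = (\<chi> i. real (out_degree E i))"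
  by (simp add: vec_eq_iff matrix_vector_mult_def adjacency_matrix_def out_degree_def
      sum.If_cases)

lemma pagerank_step_eq:
  "pagerank_step \<alpha> E x = \<alpha> *\<^sub>R spread E x + ((1 - \<alpha>) / real CARD('n)) *\<^sub>R 1"
  for E :: "('n::finite) rel"
proof -
  \<comment> \<open>Augmented out-degrees are positive, so the diagonal matrix is
    invertible.\<close>
  have "matrix_inv (diag (adjacency_matrix (augment E) *v 1))
      = diag (\<chi> i. inverse (real (out_degree (augment E) i)))"
    using out_degree_augment_pos[of E]
    by (subst matrix_inv_diag) (auto simp: adjacency_matrix_mult_1)
  moreover have "(transpose (adjacency_matrix (augment E))
      ** diag (\<chi> i. inverse (real (out_degree (augment E) i)))) *v x = spread E x"
  proof (rule vec_eq_iff[THEN iffD2, rule_format])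
    fix i
    show "((transpose (adjacency_matrix (augment E))
        ** diag (\<chi> i. inverse (real (out_degree (augment E) i)))) *v x) $ i = spread E x $ i"
      unfolding spread_def matrix_vector_mult_def matrix_mult_diag vec_lambda_beta
      by (rule sum.mono_neutral_cong_right)
        (auto simp: transpose_def adjacency_matrix_def in_neighbors_def field_simps)
  qed
  ultimately show ?thesis
    by (simp add: pagerank_step_def Let_def)
qed

lemma linear_spread: "linear (spread E)"
  by (rule linearI)
    (simp_all add: spread_def vec_eq_iff add_divide_distrib sum.distrib sum_distrib_left)

lemma spread_diff: "spread E (x - y) = spread E x - spread E y"
  by (rule linear_diff[OF linear_spread])

text \<open>Conservation of mass: after swapping the sums, each \<open>j\<close> sends an equal
  share of \<open>f j\<close> along each of its augmented out-edges, and there is at least one. It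
  is applied both to the entries of a vector and to their absolute values.\<close>

lemma sum_in_neighbors_augment:
  fixes f :: "'n::finite \<Rightarrow> real"
  shows "(\<Sum>i\<in>UNIV. \<Sum>j\<in>in_neighbors (augment E) i. f j / real (out_degree (augment E) j))
    = (\<Sum>j\<in>UNIV. f j)"
proof -
  have "(\<Sum>i\<in>UNIV. \<Sum>j\<in>in_neighbors (augment E) i. f j / real (out_degree (augment E) j))
      = (\<Sum>j\<in>UNIV. \<Sum>i | (j, i) \<in> augment E. f j / real (out_degree (augment E) j))"
    using sum.swap_restrict[of UNIV UNIV "\<lambda>i j. f j / real (out_degree (augment E) j)"
        "\<lambda>i j. (j, i) \<in> augment E"]
    by (simp add: in_neighbors_def)
  also have "\<dots> = (\<Sum>j\<in>UNIV. f j)"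
  proof (rule sum.cong)
    fix j
    show "(\<Sum>i | (j, i) \<in> augment E. f j / real (out_degree (augment E) j)) = f j"
      using out_degree_augment_pos[of E j] by (simp flip: out_degree_def)
  qed simp
  finally show ?thesis .
qed

lemma l1_norm_spread_le: "l1_norm (spread E x) \<le> l1_norm x"
proof -
  have "l1_norm (spread E x)
      \<le> (\<Sum>i\<in>UNIV. \<Sum>j\<in>in_neighbors (augment E) i. \<bar>x $ j\<bar> / real (out_degree (augment E) j))"
    unfolding l1_norm_def spread_def
    by (intro sum_mono) (simp add: order_trans[OF sum_abs])
  then show ?thesis
    by (simp add: sum_in_neighbors_augment l1_norm_def)
qed

section \<open>Contraction and the fixed point\<close>

lemma pagerank_step_contraction:
  assumes "0 \<le> \<alpha>"
  shows "l1_norm (pagerank_step \<alpha> E x - pagerank_step \<alpha> E y) \<le> \<alpha> * l1_norm (x - y)"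
proof -
  have "pagerank_step \<alpha> E x - pagerank_step \<alpha> E y = \<alpha> *\<^sub>R spread E (x - y)"
    by (simp add: pagerank_step_eq spread_diff scaleR_diff_right)
  then show ?thesis
    using assms by (simp add: l1_norm_scaleR l1_norm_spread_le mult_left_mono)
qed

text \<open>The a posteriori estimate of Banach's fixed point theorem: the length of one step from
  \<open>y\<close> controls the distance of \<open>y\<close> to the fixed point.\<close>

lemma l1_dist_fixed_point_le:
  assumes "0 \<le> \<alpha>" "\<alpha> < 1" "pagerank_step \<alpha> E x = x"
  shows "l1_norm (x - y) \<le> l1_norm (y - pagerank_step \<alpha> E y) / (1 - \<alpha>)"
proof -
  have "l1_norm (x - y) \<le> l1_norm (x - pagerank_step \<alpha> E y) + l1_norm (pagerank_step \<alpha> E y - y)"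
    using l1_norm_triangle[of "x - pagerank_step \<alpha> E y" "pagerank_step \<alpha> E y - y"] by simp
  also have "\<dots> \<le> \<alpha> * l1_norm (x - y) + l1_norm (y - pagerank_step \<alpha> E y)"
    using pagerank_step_contraction[OF assms(1), of E x y] assms(3)
    by (simp add: l1_norm_minus_commute)
  finally show ?thesis
    using assms(2) by (simp add: field_simps)
qed

lemma pagerank_fixed_point_unique:
  assumes "0 \<le> \<alpha>" "\<alpha> < 1" "pagerank_step \<alpha> E x = x" "pagerank_step \<alpha> E y = y"
  shows "x = y"
proof -
  have "l1_norm (x - y) \<le> 0"
    using l1_dist_fixed_point_le[OF assms(1-3), of y] assms(4) by (simp add: l1_norm_def)
  moreover have "0 \<le> l1_norm (x - y)"
    by (rule l1_norm_nonneg)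
  ultimately show ?thesis
    using l1_norm_eq_0_iff[of "x - y"] by simp
qed

text \<open>
  Injectivity of \<open>I - \<alpha> P\<close> gives surjectivity in finite dimension, so no completeness argument for
  the 1-norm is needed.
\<close>
lemma pagerank_fixed_point_exists:
  fixes E :: "('n::finite) rel"
  assumes "0 \<le> \<alpha>" "\<alpha> < 1"
  obtains x where "pagerank_step \<alpha> E x = x"
proof -
  define L where "L x = x - \<alpha> *\<^sub>R spread E x" for x
  have "linear L"
    unfolding L_def by (intro linear_compose_sub linear_compose_scale_right linear_spread linear_ident)
  moreover have "inj L"
  proof (rule injI)
    fix x y assume "L x = L y"
    then have "x - y = \<alpha> *\<^sub>R spread E (x - y)"
      by (simp add: L_def spread_diff algebra_simps)
    then have "l1_norm (x - y) \<le> \<alpha> * l1_norm (x - y)"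
      by (metis abs_of_nonneg assms(1) l1_norm_scaleR l1_norm_spread_le mult_left_mono)
    then have "(1 - \<alpha>) * l1_norm (x - y) \<le> 0"
      by (simp add: algebra_simps)
    moreover have "0 \<le> l1_norm (x - y)"
      by (rule l1_norm_nonneg)
    ultimately have "l1_norm (x - y) = 0"
      using assms(2) by (simp add: mult_le_0_iff)
    then show "x = y"
      using l1_norm_eq_0_iff[of "x - y"] by simp
  qed
  ultimately have "surj L"
    by (rule eucl.linear_inj_imp_surj)
  then obtain x where "L x = ((1 - \<alpha>) / real CARD('n)) *\<^sub>R 1"
    by (metis surjD)
  then have "pagerank_step \<alpha> E x = x"
    by (simp add: pagerank_step_eq L_def algebra_simps)
  then show ?thesis by (rule that)
qed

text \<open>The sign of \<open>x\<close> is not known here. Conservation of mass makes the entries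
  sum to 1, which bounds the norm from below; the triangle inequality bounds it from above.\<close>

lemma l1_norm_fixed_point:
  fixes E :: "('n::finite) rel"
  assumes "0 \<le> \<alpha>" "\<alpha> < 1" "pagerank_step \<alpha> E x = x"
  shows "l1_norm x = 1"
proof -
  let ?b = "((1 - \<alpha>) / real CARD('n)) *\<^sub>R (1 :: real^'n)"
  have x: "x = \<alpha> *\<^sub>R spread E x + ?b"
    using assms(3) by (simp add: pagerank_step_eq)
  have "(\<Sum>i\<in>UNIV. spread E x $ i) = (\<Sum>i\<in>UNIV. x $ i)"
    by (simp add: spread_def sum_in_neighbors_augment)
  moreover have "(\<Sum>i\<in>UNIV. x $ i) = \<alpha> * (\<Sum>i\<in>UNIV. spread E x $ i) + (1 - \<alpha>)"
    by (subst x) (simp add: sum.distrib sum_distrib_left)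
  ultimately have "(1 - \<alpha>) * (\<Sum>i\<in>UNIV. x $ i) = (1 - \<alpha>) * 1"
    by (simp add: algebra_simps)
  then have "(\<Sum>i\<in>UNIV. x $ i) = 1"
    using assms(2) by simp
  then have "1 \<le> l1_norm x"
    unfolding l1_norm_def by (metis abs_ge_self sum_mono)
  moreover have "l1_norm x \<le> \<alpha> * l1_norm x + (1 - \<alpha>)"
  proof -
    have "l1_norm x \<le> l1_norm (\<alpha> *\<^sub>R spread E x) + l1_norm ?b"
      by (metis x l1_norm_triangle)
    also have "l1_norm ?b = 1 - \<alpha>"
      using assms(2) by (simp add: l1_norm_def)
    also have "l1_norm (\<alpha> *\<^sub>R spread E x) \<le> \<alpha> * l1_norm x"
      using assms(1) by (simp add: l1_norm_scaleR l1_norm_spread_le mult_left_mono)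
    finally show ?thesis by simp
  qed
  then have "(1 - \<alpha>) * l1_norm x \<le> (1 - \<alpha>) * 1"
    by (simp add: algebra_simps)
  then have "l1_norm x \<le> 1"
    using assms(2) by (simp only: mult_le_cancel_left_pos diff_gt_0_iff_gt)
  ultimately show ?thesis by simp
qed

text \<open>Existence, uniqueness and automatic normalization make the definite description in
  \<open>pagerank\<close> meaningful.\<close>

lemma pagerank_step_pagerank:
  assumes "0 \<le> \<alpha>" "\<alpha> < 1"
  shows "pagerank_step \<alpha> E (pagerank \<alpha> E) = pagerank \<alpha> E"
proof -
  obtain x where x: "pagerank_step \<alpha> E x = x"
    using pagerank_fixed_point_exists[OF assms] by blast
  have "pagerank_step \<alpha> E (pagerank \<alpha> E) = pagerank \<alpha> E \<and> l1_norm (pagerank \<alpha> E) = 1"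
    unfolding pagerank_def
  proof (rule theI)
    show "pagerank_step \<alpha> E x = x \<and> l1_norm x = 1"
      using x l1_norm_fixed_point[OF assms x] by blast
  qed (use x pagerank_fixed_point_unique[OF assms] in blast)
  then show ?thesis ..
qed

section \<open>Colors determine the iterates\<close>

text \<open>Separates what depends on \<open>v\<close>, a sum over its original in-neighbors, from
  the dangling mass, which is the same at every node.\<close>

lemma spread_nth:
  "spread E x $ v = (\<Sum>u\<in>in_neighbors E v. x $ u / real (out_degree E u))
    + (\<Sum>u | out_degree E u = 0. x $ u) / real CARD('n)"
  for E :: "('n::finite) rel"
proof -
  have "spread E x $ v = (\<Sum>u\<in>in_neighbors E v. x $ u / real (out_degree (augment E) u))
      + (\<Sum>u | out_degree E u = 0. x $ u / real (out_degree (augment E) u))"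
    unfolding spread_def in_neighbors_augment
    by (simp add: sum.union_disjoint disjoint_iff out_degree_in_neighbors)
  then show ?thesis
    by (simp add: out_degree_augment out_degree_in_neighbors sum_divide_distrib cong: sum.cong_simp)
qed

text \<open>An injective hash lets each round be undone. Two graphs and two nodes are allowed, since
  the lemma compares one node across graphs and also equally colored nodes of one graph.\<close>

lemma color_refinement_eq_antimono:
  assumes "inj hash" "s \<le> t" "color_refinement hash E c t v = color_refinement hash E' c' t w"
  shows "color_refinement hash E c s v = color_refinement hash E' c' s w"
  using assms(2,3)
proof (induction rule: inc_induct)
  case (step m)
  then show ?case using injD[OF assms(1)] by fastforce
qed simp

text \<open>
  The colors must agree at every node, because the mass of dangling nodes enters every coordinate.
\<close>
lemma pagerank_iterate_color:
  fixes E E' :: "('n::finite) rel"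
  assumes "inj hash"
    and "\<And>v. color_refinement hash E (out_degree E) t v
      = color_refinement hash E' (out_degree E') t v"
  shows "\<exists>f. \<forall>v. pagerank_iterate \<alpha> E (c *\<^sub>R 1) t $ v
        = f (color_refinement hash E (out_degree E) t v)
      \<and> pagerank_iterate \<alpha> E' (c *\<^sub>R 1) t $ v
        = f (color_refinement hash E (out_degree E) t v)"
  using assms(2)
proof (induction t)
  case 0
  show ?case
    by (rule exI[of _ "\<lambda>_. c"]) (simp add: pagerank_iterate_def)
next
  case (Suc t)
  define col where "col = color_refinement hash E (out_degree E) t"
  define M where "M v = image_mset col (mset_set (in_neighbors E v))" for v
  have col': "color_refinement hash E' (out_degree E') t = col"
    unfolding col_def
    using color_refinement_eq_antimono[OF assms(1) le_SucI[OF order_refl] Suc.prems] by auto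
  have deg: "out_degree E' v = out_degree E v" for v
    using color_refinement_eq_antimono[OF assms(1) le0 Suc.prems[of v]] by simp
  have Suc_eq: "color_refinement hash E (out_degree E) (Suc t) v = hash (col v, M v)" for v
    by (simp add: col_def M_def)
  have "color_refinement hash E' (out_degree E') (Suc t) v
      = hash (col v, image_mset col (mset_set (in_neighbors E' v)))" for v
    by (simp add: col')
  \<comment> \<open>Injectivity turns equal colors at depth \<open>Suc t\<close> into equal
    multisets of in-neighbor colors at depth \<open>t\<close>.\<close>
  then have M': "M v = image_mset col (mset_set (in_neighbors E' v))" for v
    using Suc.prems[of v] injD[OF assms(1)] unfolding Suc_eq by (metis prod.inject)
  obtain f where f: "\<And>v. pagerank_iterate \<alpha> E (c *\<^sub>R 1) t $ v = f (col v)"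
      "\<And>v. pagerank_iterate \<alpha> E' (c *\<^sub>R 1) t $ v = f (col v)"
    using Suc.IH col' unfolding col_def by metis
  \<comment> \<open>Out-degree as a function of the color, read off at any node of that color; the
    choice is harmless because the color determines the initial color.\<close>
  define g where "g a = out_degree E (inv col a)" for a
  have g: "g (col v) = out_degree E v" for v
  proof -
    have "col (inv col (col v)) = col v"
      by (simp add: f_inv_into_f)
    from color_refinement_eq_antimono[OF assms(1) le0 this[unfolded col_def]] show ?thesis
      by (simp add: g_def col_def)
  qed
  \<comment> \<open>The dangling contribution, common to both graphs because out-degrees and
    iterates agree at every node.\<close>
  define q where "q = (\<Sum>u | out_degree E u = 0. f (col u)) / real CARD('n)"
  \<comment> \<open>\<open>snd (inv hash a)\<close> recovers the multiset of in-neighbor colors from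
    a new color \<open>a\<close>; the PageRank update needs nothing else.\<close>
  define h where "h a = \<alpha> * ((\<Sum>b\<in>#snd (inv hash a). f b / real (g b)) + q)
      + (1 - \<alpha>) / real CARD('n)" for a
  have "spread E (pagerank_iterate \<alpha> E (c *\<^sub>R 1) t) $ v = (\<Sum>b\<in>#M v. f b / real (g b)) + q" for v
    by (simp add: spread_nth f g q_def M_def sum_unfold_sum_mset image_mset.compositionality o_def)
  moreover have "spread E' (pagerank_iterate \<alpha> E' (c *\<^sub>R 1) t) $ v
      = (\<Sum>b\<in>#M v. f b / real (g b)) + q" for v
    by (simp add: spread_nth f g deg q_def M' sum_unfold_sum_mset image_mset.compositionality o_def)
  ultimately have "pagerank_iterate \<alpha> E (c *\<^sub>R 1) (Suc t) $ v = h (hash (col v, M v))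
      \<and> pagerank_iterate \<alpha> E' (c *\<^sub>R 1) (Suc t) $ v = h (hash (col v, M v))" for v
    by (simp add: pagerank_iterate_def pagerank_step_eq h_def inv_f_f[OF assms(1)])
  then show ?case
    unfolding Suc_eq by blast
qed

lemma pagerank_iterate_eq:
  assumes "inj hash"
    and "E \<in> refinement_neighborhood hash out_degree d G"
    and "E' \<in> refinement_neighborhood hash out_degree d G"
    and "t \<le> d"
  shows "pagerank_iterate \<alpha> E (c *\<^sub>R 1) t = pagerank_iterate \<alpha> E' (c *\<^sub>R 1) t"
proof -
  have "color_refinement hash E (out_degree E) t v = color_refinement hash E' (out_degree E') t v"
    for v
    using assms by (intro color_refinement_eq_antimono[OF assms(1,4)])
      (simp add: refinement_neighborhood_def)
  from pagerank_iterate_color[OF assms(1) this, of \<alpha> c] show ?thesis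
    by (auto simp: vec_eq_iff)
qed

theorem corollary4p4:
  fixes hash :: "nat \<times> nat multiset \<Rightarrow> nat"
    and G G\<^sub>1 G\<^sub>2 :: "('n::finite) rel"
    and d k :: nat
    and \<alpha> c :: real
    and x xt :: "real^'n"
  assumes "inj hash"
    and "1 \<le> d"
    and "0 \<le> \<alpha>" and "\<alpha> < 1"
    and "G\<^sub>1 \<in> refinement_neighborhood hash out_degree d G"
    and "G\<^sub>2 \<in> refinement_neighborhood hash out_degree d G"
    and "x = pagerank \<alpha> G\<^sub>1" and "xt = pagerank \<alpha> G\<^sub>2"
    and "0 \<le> c"
    and "1 \<le> k" and "k \<le> d"
  shows "l1_norm (x - xt)
           \<le> 2 / (1 - \<alpha>) *
             l1_norm (pagerank_iterate \<alpha> G\<^sub>1 (c *\<^sub>R 1) (k - 1) - pagerank_iterate \<alpha> G\<^sub>1 (c *\<^sub>R 1) k)"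
proof -
  let ?it = "\<lambda>E t. pagerank_iterate \<alpha> E (c *\<^sub>R 1) t"
  \<comment> \<open>\<open>1 \<le> k\<close> makes \<open>k - 1\<close> and \<open>k\<close>
    consecutive; at \<open>k = 0\<close> truncated subtraction would make them equal.\<close>
  have step: "pagerank_step \<alpha> E (?it E (k - 1)) = ?it E k" for E :: "'n rel"
    using \<open>1 \<le> k\<close> by (cases k) (simp_all add: pagerank_iterate_def)
  have bound: "l1_norm (pagerank \<alpha> E - ?it E (k - 1)) \<le> l1_norm (?it E (k - 1) - ?it E k) / (1 - \<alpha>)"
    for E :: "'n rel"
    using l1_dist_fixed_point_le[OF assms(3,4) pagerank_step_pagerank[OF assms(3,4)],
        of E "?it E (k - 1)"]
    by (simp only: step)
  \<comment> \<open>With both iterates shared, the estimate for \<open>G\<^sub>2\<close> has the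
    same center and radius as the one for \<open>G\<^sub>1\<close>; the two radii add up to the
    factor 2.\<close>
  have same: "?it G\<^sub>2 k = ?it G\<^sub>1 k" "?it G\<^sub>2 (k - 1) = ?it G\<^sub>1 (k - 1)"
    using \<open>k \<le> d\<close> by (auto intro!: pagerank_iterate_eq[OF assms(1,6,5)])
  have "l1_norm (x - ?it G\<^sub>1 (k - 1)) \<le> l1_norm (?it G\<^sub>1 (k - 1) - ?it G\<^sub>1 k) / (1 - \<alpha>)"
    using bound[of G\<^sub>1] by (simp only: assms(7))
  moreover have "l1_norm (xt - ?it G\<^sub>1 (k - 1)) \<le> l1_norm (?it G\<^sub>1 (k - 1) - ?it G\<^sub>1 k) / (1 - \<alpha>)"
    using bound[of G\<^sub>2] by (simp only: assms(8) same)
  moreover have "l1_norm (x - xt) \<le> l1_norm (x - ?it G\<^sub>1 (k - 1)) + l1_norm (xt - ?it G\<^sub>1 (k - 1))"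
    using l1_norm_triangle[of "x - ?it G\<^sub>1 (k - 1)" "?it G\<^sub>1 (k - 1) - xt"]
    by (simp add: l1_norm_minus_commute[of xt])
  ultimately show ?thesis
    by simp
qed

end
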